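(* Let $k<n\leqslant 2k$ be natural numbers. Then every graph $G$ on $n$ vertices satisfies $h_k(G)\geqslant f_0(n,k)$.
   Context: All graphs are finite, undirected, without loops or multiple edges. For a graph $G$ and a natural number $k$, $h_k(G)$ denotes the number of unordered pairs of distinct vertices of $G$ whose degrees differ by less than $k$. For natural numbers $n>k$, $$f_0(n,k):=\left(\left\lceil \tfrac{n}{k} \right\rceil - 2\right)\binom{k}{2} + \binom{k+1}{2} + \binom{n-k \left( \left\lceil\frac{n}{k} \right\rceil - 1 \right)-1}{2},$$ where $\binom{m}{2}=m(m-1)/2$. *)

theory Defs
  imports Complex_Main "Graph_Theory.Digraph"
begin

text \<open>
  Finite simple undirected graphs are those of the locale \<^locale>\<open>graph\<close>: finite loop-free
  symmetric digraphs without parallel arcs, an edge between \<open>u\<close> and \<open>v\<close> being the pair of arcs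
  from \<open>u\<close> to \<open>v\<close> and from \<open>v\<close> to \<open>u\<close>. The degree of a vertex is therefore its
  \<^const>\<open>out_degree\<close>.
\<close>

definition close_pairs :: "nat \<Rightarrow> ('a, 'b) pre_digraph \<Rightarrow> 'a set set" where
  "close_pairs k G = {{u, v} | u v. u \<in> verts G \<and> v \<in> verts G \<and> u \<noteq> v \<and>
     \<bar>int (out_degree G u) - int (out_degree G v)\<bar> < int k}"

definition h :: "nat \<Rightarrow> ('a, 'b) pre_digraph \<Rightarrow> nat" where
  "h k G = card (close_pairs k G)"

text \<open>
  Meant for \<open>n > k \<ge> 1\<close>. Then \<open>\<lceil>n / k\<rceil> \<ge> 2\<close> and \<open>k * (\<lceil>n / k\<rceil> - 1) < n\<close>,
  so none of the subtractions on natural numbers truncates.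
\<close>

definition f0 :: "nat \<Rightarrow> nat \<Rightarrow> nat" where
  "f0 n k = (let c = nat \<lceil>real n / real k\<rceil> in
     (c - 2) * (k choose 2) + ((k + 1) choose 2) + ((n - k * (c - 1) - 1) choose 2))"

end

theory Submission
  imports Defs
begin

text \<open>
  Sort the vertices by degree and compare the \<open>n - k\<close> smallest degrees with the \<open>n - k\<close> largest
  ones: double counting the edges between these two groups shows that the \<open>j\<close>-th and the
  \<open>(j + k)\<close>-th smallest degrees differ by less than \<open>k\<close> for some \<open>j\<close>. This gives a set \<open>W\<close> of
  \<open>k + 1\<close> vertices with pairwise close degrees. Since \<open>n \<le> 2 * k\<close>, two vertices whose degrees are
  both below \<open>k\<close>, or both at least \<open>k\<close>, are close as well, and the pairs of these three kinds are
  already numerous enough.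
\<close>

lemma (in graph) out_degree_eq_card_adj:
  "out_degree G v = card {w \<in> verts G. v \<rightarrow> w}"
proof -
  have "bij_betw (head G) (out_arcs G v) {w \<in> verts G. v \<rightarrow> w}"
    unfolding bij_betw_def
  proof
    show "inj_on (head G) (out_arcs G v)"
      by (auto simp: inj_on_def arc_to_ends_def intro!: no_multi_arcs)
    show "head G ` out_arcs G v = {w \<in> verts G. v \<rightarrow> w}"
      by (auto simp: arcs_ends_def arc_to_ends_def image_iff)
  qed
  then show ?thesis
    unfolding out_degree_def by (rule bij_betw_same_card)
qed

lemma (in graph) out_degree_less_card:
  assumes "v \<in> verts G"
  shows "out_degree G v < card (verts G)"
proof -
  have "{w \<in> verts G. v \<rightarrow> w} \<subset> verts G"
    using assms by (auto dest: adj_not_same)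
  then show ?thesis
    by (simp add: out_degree_eq_card_adj psubset_card_mono)
qed

text \<open>A vertex of \<open>T\<close> lies outside \<open>B\<close> and carries no loop, so at
  most \<open>card (verts G) - card B - 1\<close> of its neighbours are outside \<open>B\<close>.
  The edges between \<open>T\<close> and \<open>B\<close> are in turn bounded by the degree sum over
  \<open>B\<close>.\<close>

lemma (in graph) sum_out_degree_le:
  assumes T: "T \<subseteq> verts G" and B: "B \<subseteq> verts G" and disj: "T \<inter> B = {}"
  shows "(\<Sum>v\<in>T. out_degree G v) \<le>
    (\<Sum>v\<in>B. out_degree G v) + card T * (card (verts G) - card B - 1)"
proof -
  have fin: "finite T" "finite B"
    using T B finite_verts by (auto intro: finite_subset)
  have "out_degree G v \<le> card {w \<in> B. v \<rightarrow> w} + (card (verts G) - card B - 1)" if v: "v \<in> T" for v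
  proof -
    have "{w \<in> verts G. v \<rightarrow> w} \<subseteq> {w \<in> B. v \<rightarrow> w} \<union> (verts G - B - {v})"
      by (auto dest: adj_not_same)
    then have "out_degree G v \<le> card ({w \<in> B. v \<rightarrow> w} \<union> (verts G - B - {v}))"
      unfolding out_degree_eq_card_adj using fin by (intro card_mono) auto
    also have "\<dots> \<le> card {w \<in> B. v \<rightarrow> w} + card (verts G - B - {v})"
      by (rule card_Un_le)
    also have "card (verts G - B - {v}) = card (verts G) - card B - 1"
      using v T B disj fin by (subst card_Diff_singleton) (auto simp: card_Diff_subset)
    finally show ?thesis .
  qed
  then have "(\<Sum>v\<in>T. out_degree G v) \<le>
      (\<Sum>v\<in>T. card {w \<in> B. v \<rightarrow> w} + (card (verts G) - card B - 1))"
    by (rule sum_mono)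
  also have "\<dots> = (\<Sum>v\<in>T. card {w \<in> B. v \<rightarrow> w}) + card T * (card (verts G) - card B - 1)"
    by (simp add: sum.distrib)
  \<comment> \<open>Double counting: the edges between \<open>T\<close> and \<open>B\<close> are now
    grouped by their endpoint in \<open>B\<close>.\<close>
  also have "(\<Sum>v\<in>T. card {w \<in> B. v \<rightarrow> w}) = (\<Sum>w\<in>B. card {v \<in> T. v \<rightarrow> w})"
    using sum.swap_restrict[OF fin, of "\<lambda>_ _. 1::nat" "\<lambda>v w. v \<rightarrow> w"] by simp
  also have "\<dots> \<le> (\<Sum>w\<in>B. out_degree G w)"
  proof (rule sum_mono)
    fix w
    show "card {v \<in> T. v \<rightarrow> w} \<le> out_degree G w"
      unfolding out_degree_eq_card_adj using T by (intro card_mono) (auto intro: arcs_ends_symmetric[OF sym_arcs])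
  qed
  finally show ?thesis by simp
qed

lemma (in graph) ex_close_vertex_set:
  assumes "k < card (verts G)" and "card (verts G) \<le> 2 * k"
  obtains W where "W \<subseteq> verts G" and "card W = k + 1"
    and "\<And>u v. u \<in> W \<Longrightarrow> v \<in> W \<Longrightarrow> out_degree G u < out_degree G v + k"
proof -
  let ?d = "out_degree G" and ?n = "card (verts G)"
  obtain ys where ys: "set ys = verts G" "distinct ys"
    using finite_distinct_list[OF finite_verts] by blast
  define xs where "xs = sort_key ?d ys"
  have set_xs: "set xs = verts G" and dist: "distinct xs" and "sorted (map ?d xs)"
    using ys by (auto simp: xs_def)
  have len: "length xs = ?n"
    using set_xs dist distinct_card by force
  have mono: "?d (xs ! i) \<le> ?d (xs ! j)" if "i \<le> j" "j < ?n" for i j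
    using sorted_nth_mono[OF \<open>sorted (map ?d xs)\<close>, of i j] that len by simp
  have nth_in: "xs ! i \<in> verts G" if "i < ?n" for i
    using that len set_xs nth_mem by metis
  \<comment> \<open>There are \<open>m\<close> positions \<open>j\<close> for which
    \<open>j + k\<close> is a position too. Since \<open>m \<le> k\<close>, the \<open>m\<close>
    largest and the \<open>m\<close> smallest entries do not overlap.\<close>
  define m where "m = ?n - k"
  define T where "T = (\<lambda>j. xs ! (j + k)) ` {..<m}"
  define B where "B = (\<lambda>j. xs ! j) ` {..<m}"
  have m: "0 < m" "m \<le> k" "m + k = ?n"
    using assms by (auto simp: m_def)
  have injT: "inj_on (\<lambda>j. xs ! (j + k)) {..<m}" and injB: "inj_on (\<lambda>j. xs ! j) {..<m}"
    using dist len m by (auto simp: inj_on_def nth_eq_iff_index_eq)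
  have "T \<inter> B = {}"
    using dist len m by (auto simp: T_def B_def nth_eq_iff_index_eq)
  moreover have "T \<subseteq> verts G" "B \<subseteq> verts G"
    using nth_in m by (auto simp: T_def B_def)
  moreover have "card T = m" "card B = m"
    using injT injB by (simp_all add: T_def B_def card_image)
  \<comment> \<open>On average a vertex of \<open>T\<close> exceeds one of \<open>B\<close> by at
    most \<open>k - 1\<close>. The vertex itself accounts for the \<open>- 1\<close>, which makes
    the comparison with \<open>k\<close> strict.\<close>
  moreover have "?n - m - 1 = k - 1"
    using m by simp
  ultimately have "(\<Sum>v\<in>T. ?d v) \<le> (\<Sum>v\<in>B. ?d v) + m * (k - 1)"
    using sum_out_degree_le[of T B] by simp
  then have "(\<Sum>j<m. ?d (xs ! (j + k))) \<le> (\<Sum>j<m. ?d (xs ! j) + (k - 1))"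
    using injT injB by (simp add: T_def B_def sum.reindex sum.distrib)
  also have "\<dots> < (\<Sum>j<m. ?d (xs ! j) + k)"
    using m by (intro sum_strict_mono) auto
  \<comment> \<open>If the gap were at least \<open>k\<close> at every \<open>j < m\<close>, summing
    over \<open>j\<close> would contradict the strict inequality.\<close>
  finally obtain j where j: "j < m" "?d (xs ! (j + k)) < ?d (xs ! j) + k"
    by (meson lessThan_iff not_less sum_mono)
  show thesis
  proof
    \<comment> \<open>A block of consecutive entries in sorted order: all its degrees lie between
      those at positions \<open>j\<close> and \<open>j + k\<close>.\<close>
    let ?W = "(\<lambda>i. xs ! i) ` {j..j + k}"
    show "?W \<subseteq> verts G"
      using nth_in j m by auto
    have "inj_on (\<lambda>i. xs ! i) {j..j + k}"
      using dist len j m by (auto simp: inj_on_def nth_eq_iff_index_eq)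
    then show "card ?W = k + 1"
      by (simp add: card_image)
    fix u v assume "u \<in> ?W" "v \<in> ?W"
    then obtain a b where "u = xs ! a" "v = xs ! b" "a \<le> j + k" "j \<le> b" "b \<le> j + k"
      by auto
    then have "?d u \<le> ?d (xs ! (j + k))" "?d (xs ! j) \<le> ?d v"
      using mono j m by auto
    then show "?d u < ?d v + k"
      using j by linarith
  qed
qed

lemma choose_two_add: "(a + b) choose 2 = (a choose 2) + (b choose 2) + a * (b::nat)"
proof (induction b)
  case (Suc b)
  then show ?case by (simp add: numeral_2_eq_2)
qed simp

text \<open>In the application, \<open>r1\<close>, \<open>r2\<close> count the vertices of the two
  classes outside \<open>W\<close>, and \<open>w1\<close>, \<open>w2\<close> those inside. Expanding
  by \<open>choose_two_add\<close> cancels the pairs within each of the four groups, so only the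
  mixed products have to be compared.\<close>

lemma choose_two_exchange:
  fixes r1 r2 w1 w2 :: nat
  assumes "r1 + r2 \<le> w1 + w2"
  shows "((r1 + r2) choose 2) + (w1 choose 2) + (w2 choose 2)
    \<le> ((r1 + w1) choose 2) + ((r2 + w2) choose 2)"
proof -
  have "r1 * r2 \<le> r1 * w1 + r2 * w2"
  proof (cases "r1 \<le> w2")
    case True
    then have "r2 * r1 \<le> r2 * w2" by (rule mult_le_mono2)
    then show ?thesis unfolding mult.commute[of r1 r2] by (rule trans_le_add2)
  \<comment> \<open>Here \<open>w2 < r1\<close>, so the assumption forces
    \<open>r2 \<le> w1\<close>.\<close>
  next
    case False
    then have "r1 * r2 \<le> r1 * w1" using assms by simp
    then show ?thesis by (rule trans_le_add1)
  qed
  then show ?thesis by (simp add: choose_two_add)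
qed

text \<open>To the pairs inside \<open>W\<close> are added those inside \<open>L\<close> or
  \<open>H\<close> that are not inside \<open>W\<close>. Each class \<open>S\<close> contributes
  \<open>card S choose 2\<close> minus \<open>card (S \<inter> W) choose 2\<close>, and
  \<open>choose_two_exchange\<close> bounds the sum of the two contributions. Its hypothesis says
  that at most half of \<open>V\<close> lies outside \<open>W\<close>.\<close>

lemma card_pairs_within_ge:
  assumes "finite V" and "L \<inter> H = {}" and "V = L \<union> H" and W: "W \<subseteq> V"
    and half: "card V \<le> 2 * card W"
  shows "(card W choose 2) + ((card V - card W) choose 2) \<le>
    card {X. (X \<subseteq> W \<or> X \<subseteq> L \<or> X \<subseteq> H) \<and> card X = 2}"
proof -
  define P where "P S = {X. X \<subseteq> S \<and> card X = 2}" for S :: "'a set"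
  have fin: "finite L" "finite H" "finite W"
    using assms by (auto intro: finite_subset)
  have card_P: "card (P S) = card S choose 2" and fin_P: "finite (P S)" if "finite S" for S
    using that by (auto simp: P_def n_subsets)
  have card_diff: "card (P S - P W) + (card (S \<inter> W) choose 2) = card S choose 2"
    if "finite S" for S
  proof -
    have "P S \<inter> P W = P (S \<inter> W)" by (auto simp: P_def)
    then show ?thesis
      using card_Int_Diff[of "P S" "P W"] that by (simp add: card_P fin_P add.commute)
  qed
  \<comment> \<open>No pair is counted for both classes, since it would lie in the empty set
    \<open>L \<inter> H\<close>.\<close>
  have "P L \<inter> P H = {}"
  proof -
    have False if "X \<in> P L" "X \<in> P H" for X
    proof -
      have "X \<subseteq> L \<inter> H" "card X = 2" using that by (auto simp: P_def)
      then show False using \<open>L \<inter> H = {}\<close> by simp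
    qed
    then show ?thesis by blast
  qed
  have "{X. (X \<subseteq> W \<or> X \<subseteq> L \<or> X \<subseteq> H) \<and> card X = 2} = P W \<union> ((P L - P W) \<union> (P H - P W))"
    by (auto simp: P_def)
  also have "card \<dots> = card (P W) + card ((P L - P W) \<union> (P H - P W))"
    using fin fin_P by (intro card_Un_disjoint) auto
  also have "card ((P L - P W) \<union> (P H - P W)) = card (P L - P W) + card (P H - P W)"
    using fin fin_P \<open>P L \<inter> P H = {}\<close> by (intro card_Un_disjoint) auto
  finally have count: "card {X. (X \<subseteq> W \<or> X \<subseteq> L \<or> X \<subseteq> H) \<and> card X = 2} =
      (card W choose 2) + card (P L - P W) + card (P H - P W)"
    using fin by (simp add: card_P)
  define r1 r2 w1 w2 where "r1 = card (L - W)" "r2 = card (H - W)"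
    and "w1 = card (L \<inter> W)" "w2 = card (H \<inter> W)"
  note defs = this
  have L: "card L = r1 + w1" and H: "card H = r2 + w2"
    using fin card_Int_Diff[of L W] card_Int_Diff[of H W] by (auto simp: defs)
  have "W = (L \<inter> W) \<union> (H \<inter> W)" using assms by blast
  then have cW: "card W = w1 + w2"
    using fin \<open>L \<inter> H = {}\<close> card_Un_disjoint[of "L \<inter> W" "H \<inter> W"] by (auto simp: defs)
  have cV: "card V = card L + card H"
    using assms fin by (simp add: card_Un_disjoint)
  have diff: "card V - card W = r1 + r2" and "r1 + r2 \<le> w1 + w2"
    using half by (auto simp: cV cW L H)
  from choose_two_exchange[OF this(2)] show ?thesis
    using card_diff[OF fin(1)] card_diff[OF fin(2)]
    by (simp add: count diff[unfolded cW] cW L H flip: defs)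
qed

text \<open>In this range \<open>1 < n / k \<le> 2\<close>, so the ceiling is 2 and the first
  summand of \<open>f0\<close> vanishes.\<close>

lemma f0_eq:
  assumes "k < n" and "n \<le> 2 * k"
  shows "f0 n k = ((k + 1) choose 2) + ((n - (k + 1)) choose 2)"
proof -
  have "\<lceil>real n / real k\<rceil> = 2"
    using assms by (intro ceiling_unique) (auto simp: field_simps)
  then show ?thesis by (simp add: f0_def)
qed

theorem theorem3:
  fixes G :: "('a, 'b) pre_digraph" and n k :: nat
  assumes "k < n" and "n \<le> 2 * k"
    and "graph G" and "card (verts G) = n"
  shows "h k G \<ge> f0 n k"
proof -
  interpret graph G by fact
  let ?V = "verts G" and ?d = "out_degree G"
  obtain W where W: "W \<subseteq> ?V" "card W = k + 1"
    and close: "\<And>u v. u \<in> W \<Longrightarrow> v \<in> W \<Longrightarrow> ?d u < ?d v + k"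
    using ex_close_vertex_set assms by metis
  define L where "L = {v \<in> ?V. ?d v < k}"
  define H where "H = {v \<in> ?V. k \<le> ?d v}"
  \<comment> \<open>Degrees in \<open>L\<close> thus lie in \<open>{0..<k}\<close> and those in
    \<open>H\<close> in \<open>{k..<2 * k}\<close>, two intervals in which any two values differ by
    less than \<open>k\<close>.\<close>
  have less: "?d v < 2 * k" if "v \<in> ?V" for v
    using out_degree_less_card[OF that] assms by simp
  have "{X. (X \<subseteq> W \<or> X \<subseteq> L \<or> X \<subseteq> H) \<and> card X = 2} \<subseteq> close_pairs k G"
  proof
    fix X assume "X \<in> {X. (X \<subseteq> W \<or> X \<subseteq> L \<or> X \<subseteq> H) \<and> card X = 2}"
    then obtain u v where X: "X = {u, v}" "u \<noteq> v"
      and cases: "{u, v} \<subseteq> W \<or> {u, v} \<subseteq> L \<or> {u, v} \<subseteq> H"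
      by (auto simp: card_2_iff)
    have "u \<in> ?V" "v \<in> ?V"
      using cases W by (auto simp: L_def H_def)
    moreover have "?d u < ?d v + k \<and> ?d v < ?d u + k"
      using cases close less[of u] less[of v] by (auto simp: L_def H_def)
    ultimately show "X \<in> close_pairs k G"
      using X unfolding close_pairs_def by fastforce
  qed
  moreover have "finite (close_pairs k G)"
    by (rule finite_subset[of _ "Pow ?V"]) (auto simp: close_pairs_def)
  ultimately have "card {X. (X \<subseteq> W \<or> X \<subseteq> L \<or> X \<subseteq> H) \<and> card X = 2} \<le> h k G"
    unfolding h_def by (simp add: card_mono)
  moreover have "(card W choose 2) + ((card ?V - card W) choose 2) \<le>
      card {X. (X \<subseteq> W \<or> X \<subseteq> L \<or> X \<subseteq> H) \<and> card X = 2}"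
    using W assms by (intro card_pairs_within_ge) (auto simp: L_def H_def)
  ultimately show ?thesis
    using assms W by (simp add: f0_eq)
qed

end
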